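(* Let $(\omega_i,y_i)$, $i=1,\dots,n$, be data with $\omega_i\in\{1,\dots,d_1\}\times\{1,\dots,d_2\}$ (ties allowed) and $y_i\in\mathbb{R}$. Let $\lambda_1\ge0$, $\lambda_2>0$, let $m_*\ge1$ be an integer, and let $m^*=\max_\omega m_\omega$ be the maximum multiplicity of the $\omega_i$. Starting from an initial matrix $Z^{(0)}\in\mathbb{R}^{d_1\times d_2}$, define $Z^{(k)}$, $k\ge1$, by iterating the EM steps described in the context with parameters $(\lambda_1,\lambda_2,m_* )$ (without stopping). Then, as $k\to\infty$, $Z^{(k)}$ converges to a limit $Z^{(\infty)}$ which is a function of the data and $(\lambda_1,\lambda_2,m_* )$. Moreover, if $m_*\ge m^*$, then $Z^{(\infty)}=\widetilde\Theta$, where $$\widetilde\Theta=\arg\min_{M\in\mathbb{R}^{d_1\times d_2}}\Big\{\sum_{i=1}^n M_{\omega_i}^2/2-\sum_{i=1}^n y_iM_{\omega_i}+\lambda_1\|M\|_{(N)}+(\lambda_2/2)\|M\|_{(F)}^2\Big\}.$$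
   Context: $\|\cdot\|_{(N)}$ is the nuclear norm (sum of singular values) and $\|\cdot\|_{(F)}$ the Frobenius norm. Multiplicities and observed means: $m_\omega=\#\{i\le n:\omega_i=\omega\}$, and $\overline Y^{(\mathrm{obs})}_\omega=m_\omega^{-1}\sum_{i:\omega_i=\omega}y_i$ when $m_\omega\ge1$ (when $m_\omega=0$ its value is immaterial, since it is multiplied by $0$ below; take it to be $0$). Scaled soft-thresholding SVD: for a matrix $W$ with singular value decomposition $W=U\,\mathrm{diag}(\delta_1,\dots,\delta_\rho)\,V^\top$ and $a\ge0$, $b\ge0$, $$S(W;a,b)=U\,\frac{\mathrm{diag}\{(\delta_1-a)_+,\dots,(\delta_\rho-a)_+\}}{1+b}\,V^\top,\qquad t_+=\max(t,0).$$ Iteration: given $Z^{(k)}$, E-step: compute the matrix $\overline Y^{(\mathrm{imp})}$ with entries $\overline Y^{(\mathrm{imp})}_\omega=\min\{1,m_\omega/m_*\}\,\overline Y^{(\mathrm{obs})}_\omega+(1-m_\omega/m_* )_+\,Z^{(k)}_\omega$; M-step: set $Z^{(k+1)}=S(\overline Y^{(\mathrm{imp})};\lambda_1/m_*,\lambda_2/m_* )$. *)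

theory Defs
  imports "HOL-Analysis.Analysis"
begin

text \<open>Real \<open>d\<^sub>1 \<times> d\<^sub>2\<close> matrices are elements of \<^typ>\<open>real^'n^'m\<close> with \<open>d\<^sub>1 = CARD('m)\<close>
  and \<open>d\<^sub>2 = CARD('n)\<close>; positions are pairs in \<^typ>\<open>'m \<times> 'n\<close>.\<close>

abbreviation entry :: "real^'n^'m \<Rightarrow> 'm \<times> 'n \<Rightarrow> real" where
  "entry M w \<equiv> M $ fst w $ snd w"

text \<open>The norm of the type is the Frobenius norm.\<close>

abbreviation frobenius_norm :: "real^'n^'m \<Rightarrow> real" where
  "frobenius_norm M \<equiv> norm M"

lemma frobenius_norm_eq:
  "frobenius_norm (M :: real^'n^'m) = sqrt (\<Sum>i\<in>UNIV. \<Sum>j\<in>UNIV. (M $ i $ j)\<^sup>2)"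
  by (simp add: norm_vec_def L2_set_def sum_nonneg)

text \<open>The product \<open>U diag(d\<^sub>0, \<dots>, d\<^sub>r\<^sub>-\<^sub>1) V\<^sup>T\<close>, where \<open>U\<close> and \<open>V\<close> are given by
  their first \<open>r\<close> columns.\<close>

definition UdV :: "nat \<Rightarrow> (nat \<Rightarrow> real^'m) \<Rightarrow> (nat \<Rightarrow> real) \<Rightarrow> (nat \<Rightarrow> real^'n) \<Rightarrow> real^'n^'m" where
  "UdV r U d V = (\<chi> i j. \<Sum>k<r. U k $ i * d k * V k $ j)"

definition orthonormal_cols :: "nat \<Rightarrow> (nat \<Rightarrow> real^'k) \<Rightarrow> bool" where
  "orthonormal_cols r U \<longleftrightarrow> (\<forall>i<r. \<forall>j<r. U i \<bullet> U j = (if i = j then 1 else 0))"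

text \<open>Vanishing \<open>d k\<close> are permitted, so both the compact (\<open>r = rank W\<close>) and the thin
  (\<open>r = min d\<^sub>1 d\<^sub>2\<close>) decompositions are covered. The order of the singular values
  is not fixed.\<close>

definition is_svd ::
    "real^'n^'m \<Rightarrow> nat \<Rightarrow> (nat \<Rightarrow> real^'m) \<Rightarrow> (nat \<Rightarrow> real) \<Rightarrow> (nat \<Rightarrow> real^'n) \<Rightarrow> bool" where
  "is_svd W r U d V \<longleftrightarrow>
     orthonormal_cols r U \<and> orthonormal_cols r V \<and> (\<forall>k<r. 0 \<le> d k) \<and> W = UdV r U d V"

text \<open>The two values described below do not depend on the singular value decomposition
  (in the case of the soft-thresholding, for \<open>a \<ge> 0\<close>).\<close>

definition nuclear_norm :: "real^'n^'m \<Rightarrow> real" where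
  "nuclear_norm M = (THE s. \<exists>r U d V. is_svd M r U d V \<and> s = (\<Sum>k<r. d k))"

definition soft_svd :: "real^'n^'m \<Rightarrow> real \<Rightarrow> real \<Rightarrow> real^'n^'m" where
  "soft_svd W a b =
     (THE S. \<exists>r U d V. is_svd W r U d V \<and> S = UdV r U (\<lambda>k. max (d k - a) 0 / (1 + b)) V)"

text \<open>The data are \<open>(\<omega> i, y i)\<close> for \<open>i \<in> {1..n}\<close>; other values of \<open>\<omega>\<close> and \<open>y\<close> play
  no role.\<close>

definition obs_count :: "nat \<Rightarrow> (nat \<Rightarrow> 'm \<times> 'n) \<Rightarrow> 'm \<times> 'n \<Rightarrow> nat" where
  "obs_count n \<omega> w = card {i \<in> {1..n}. \<omega> i = w}"

definition max_obs_count :: "nat \<Rightarrow> (nat \<Rightarrow> 'm::finite \<times> 'n::finite) \<Rightarrow> nat" where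
  "max_obs_count n \<omega> = Max (range (obs_count n \<omega>))"

text \<open>Equals \<open>0\<close> at unobserved positions, by division by zero.\<close>

definition Y_obs :: "nat \<Rightarrow> (nat \<Rightarrow> 'm \<times> 'n) \<Rightarrow> (nat \<Rightarrow> real) \<Rightarrow> 'm \<times> 'n \<Rightarrow> real" where
  "Y_obs n \<omega> y w = (\<Sum>i | i \<in> {1..n} \<and> \<omega> i = w. y i) / real (obs_count n \<omega> w)"

definition E_step ::
    "nat \<Rightarrow> (nat \<Rightarrow> 'm \<times> 'n) \<Rightarrow> (nat \<Rightarrow> real) \<Rightarrow> nat \<Rightarrow> real^'n^'m \<Rightarrow> real^'n^'m" where
  "E_step n \<omega> y m Z =
     (\<chi> i j. min 1 (real (obs_count n \<omega> (i, j)) / real m) * Y_obs n \<omega> y (i, j)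
            + max (1 - real (obs_count n \<omega> (i, j)) / real m) 0 * Z $ i $ j)"

definition M_step :: "real \<Rightarrow> real \<Rightarrow> nat \<Rightarrow> real^'n^'m \<Rightarrow> real^'n^'m" where
  "M_step l1 l2 m Y = soft_svd Y (l1 / real m) (l2 / real m)"

primrec em_iter ::
    "nat \<Rightarrow> (nat \<Rightarrow> 'm \<times> 'n) \<Rightarrow> (nat \<Rightarrow> real) \<Rightarrow> real \<Rightarrow> real \<Rightarrow> nat \<Rightarrow> real^'n^'m
      \<Rightarrow> nat \<Rightarrow> real^'n^'m" where
  "em_iter n \<omega> y l1 l2 m Z0 0 = Z0"
| "em_iter n \<omega> y l1 l2 m Z0 (Suc k) =
     M_step l1 l2 m (E_step n \<omega> y m (em_iter n \<omega> y l1 l2 m Z0 k))"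

definition objective ::
    "nat \<Rightarrow> (nat \<Rightarrow> 'm \<times> 'n) \<Rightarrow> (nat \<Rightarrow> real) \<Rightarrow> real \<Rightarrow> real \<Rightarrow> real^'n^'m \<Rightarrow> real" where
  "objective n \<omega> y l1 l2 M =
     (\<Sum>i=1..n. (entry M (\<omega> i))\<^sup>2 / 2) - (\<Sum>i=1..n. y i * entry M (\<omega> i))
     + l1 * nuclear_norm M + (l2 / 2) * (frobenius_norm M)\<^sup>2"

end

theory Submission imports Defs begin

text \<open>
  Soft-thresholding of singular values is, up to the factor \<open>1 + b\<close>, the proximal map of \<open>a\<close> times
  the nuclear norm: if \<open>S\<close> is \<open>W\<close> with its singular values lowered to \<open>(d - a)\<^sub>+\<close>, then
  the residual \<open>W - S\<close> has the singular values \<open>min d a\<close>, so its spectral norm is at most \<open>a\<close>,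
  while its inner product with \<open>S\<close> is the largest possible, \<open>a\<close> times the nuclear norm of \<open>S\<close>
  (\<open>nuclear_prox_UdV\<close>). In other words, \<open>W - S\<close> is \<open>a\<close> times a subgradient of the nuclear norm
  at \<open>S\<close>. What makes this work is the duality between the spectral and the nuclear norm,
  \<open>inner_UdV_le\<close>, together with the existence of singular value decompositions, \<open>svd_exists\<close>.

  Subgradients are monotone, so the proximal map is nonexpansive. This has two consequences.
  Two decompositions of one matrix give the same thresholded matrix, so that \<open>soft_svd\<close>
  is well defined; and \<open>soft_svd\<close> is Lipschitz with constant \<open>1 / (1 + b)\<close>. The E-step multiplies the
  entries of the current iterate by factors in \<open>[0, 1]\<close> and adds a constant matrix, so one EM round
  is a contraction with factor \<open>1 / (1 + \<lambda>\<^sub>2 / m\<^sub>*) < 1\<close>. By Banach's theorem it has a unique fixed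
  point, to which the iterates converge from every starting matrix.

  If no multiplicity exceeds \<open>m\<^sub>*\<close>, then \<open>m\<^sub>*\<close> times the increment of \<open>Z\<close> in the E-step is the negative
  gradient at \<open>Z\<close> of the data term of the objective (\<open>E_step_residual\<close>). The subgradient condition
  at the fixed point, multiplied by \<open>m\<^sub>*\<close>, is then the first-order optimality condition of the convex
  objective, and the ridge term makes the minimum strict (\<open>em_fixed_point_objective_gap\<close>).
\<close>

section \<open>Existence of singular value decompositions\<close>

lemma UdV_mult_vec:
  "UdV r U d V *v x = (\<Sum>k<r. (d k * (V k \<bullet> x)) *\<^sub>R U k)"
  by (simp add: vec_eq_iff UdV_def matrix_vector_mult_def inner_vec_def sum_distrib_left
      sum_distrib_right sum.swap[of _ _ "{..<r}"] mult_ac)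

lemma inner_UdV:
  "UdV r U c V \<bullet> A = (\<Sum>k<r. c k * (U k \<bullet> (A *v V k)))"
proof -
  have "UdV r U c V \<bullet> A = (\<Sum>i\<in>UNIV. \<Sum>j\<in>UNIV. \<Sum>k<r. U k $ i * c k * V k $ j * A $ i $ j)"
    by (simp add: UdV_def inner_vec_def sum_distrib_right)
  also have "\<dots> = (\<Sum>k<r. \<Sum>i\<in>UNIV. \<Sum>j\<in>UNIV. U k $ i * c k * V k $ j * A $ i $ j)"
    by (simp add: sum.swap[of _ _ "{..<r}"])
  also have "\<dots> = (\<Sum>k<r. c k * (U k \<bullet> (A *v V k)))"
    by (simp add: inner_vec_def matrix_vector_mult_def sum_distrib_left mult_ac)
  finally show ?thesis .
qed

lemma orthonormal_cols_Suc:
  assumes "orthonormal_cols r U" and "\<And>k. k < r \<Longrightarrow> U k \<bullet> u = 0" and "norm u = 1"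
  shows "orthonormal_cols (Suc r) (U(r := u))"
proof -
  have "u \<bullet> u = 1" using assms(3) by (simp add: norm_eq_1)
  then show ?thesis
    using assms(1,2) by (auto simp: orthonormal_cols_def less_Suc_eq inner_commute)
qed

text \<open>A maximiser \<open>(u, v)\<close> of \<open>u \<bullet> (W *v v)\<close> over pairs of unit vectors is a pair of singular vectors
  for the largest singular value, because Cauchy-Schwarz is an equality there in either argument.\<close>

lemma top_singular_pair:
  fixes W :: "real^'n^'m"
  assumes "W \<noteq> 0"
  obtains \<sigma> u v where "\<sigma> > 0" and "norm u = 1" and "norm v = 1"
    and "W *v v = \<sigma> *\<^sub>R u" and "u v* W = \<sigma> *\<^sub>R v"
proof -
  let ?K = "sphere (0::real^'m) 1 \<times> sphere (0::real^'n) 1"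
  let ?g = "\<lambda>p. fst p \<bullet> (W *v snd p)"
  have "compact ?K" by (intro compact_Times) auto
  moreover have "?K \<noteq> {}" by simp
  moreover have "continuous_on ?K ?g"
    by (intro continuous_intros linear_continuous_on_compose[OF _ matrix_vector_mul_linear])
  ultimately obtain p where p: "p \<in> ?K" "\<And>q. q \<in> ?K \<Longrightarrow> ?g q \<le> ?g p"
    using continuous_attains_sup[of ?K ?g] by blast
  define u v \<sigma> where "u = fst p" and "v = snd p" and "\<sigma> = u \<bullet> (W *v v)"
  have nu: "norm u = 1" and nv: "norm v = 1" using p(1) by (auto simp: u_def v_def)
  have max: "x \<bullet> (W *v z) \<le> \<sigma>" if "norm x = 1" "norm z = 1" for x z
    using p(2)[of "(x, z)"] that by (simp add: \<sigma>_def u_def v_def)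
  have normW: "norm (W *v z) \<le> \<sigma> * norm z" if "W *v z \<noteq> 0" for z
  proof -
    have z: "z \<noteq> 0" using that by auto
    have "sgn (W *v z) \<bullet> (W *v sgn z) \<le> \<sigma>"
      using that z by (intro max) (simp_all add: norm_sgn)
    moreover have "sgn (W *v z) \<bullet> (W *v sgn z) = norm (W *v z) / norm z"
      by (simp add: sgn_div_norm matrix_vector_mult_scaleR dot_square_norm power2_eq_square
          divide_simps)
    ultimately show ?thesis using z by (simp add: divide_simps)
  qed
  have pos: "\<sigma> > 0"
  proof -
    obtain z where z: "W *v z \<noteq> 0"
      using assms by (metis matrix_eq matrix_vector_mult_0)
    then have "0 < \<sigma> * norm z" using normW[OF z] by (smt (verit) zero_less_norm_iff)
    then show ?thesis by (simp add: zero_less_mult_iff)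
  qed
  have inner_eq: "u \<bullet> (W *v v) = (u v* W) \<bullet> v"
    by (simp add: dot_lmul_matrix)
  have n1: "norm (W *v v) \<le> \<sigma>"
    using normW[of v] nv pos by (cases "W *v v = 0") auto
  have n2: "norm (u v* W) \<le> \<sigma>"
  proof (cases "u v* W = 0")
    case False
    let ?t = "u v* W"
    have "norm ?t = ?t \<bullet> sgn ?t"
      using False by (simp add: sgn_div_norm dot_square_norm power2_eq_square divide_simps)
    also have "\<dots> = u \<bullet> (W *v sgn ?t)"
      by (simp add: dot_lmul_matrix)
    also have "\<dots> \<le> \<sigma>" using False nu by (intro max) (simp_all add: norm_sgn)
    finally show ?thesis .
  qed (use pos in simp)
  \<comment> \<open>Equality case of Cauchy-Schwarz, to be applied to \<open>W *v v\<close> with \<open>u\<close> and to \<open>u v* W\<close> with \<open>v\<close>.\<close>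
  have eq: "x = \<sigma> *\<^sub>R e" if "norm x \<le> \<sigma>" "norm e = 1" "e \<bullet> x = \<sigma>" for x e :: "real^'k"
  proof -
    have "(norm (x - \<sigma> *\<^sub>R e))\<^sup>2 = (norm x)\<^sup>2 - \<sigma>\<^sup>2"
      unfolding power2_norm_eq_inner using that(2,3)
      by (simp add: inner_diff_left inner_diff_right inner_commute[of x e] norm_eq_1
          power2_eq_square)
    also have "\<dots> \<le> 0" using that(1) by (simp add: power_mono)
    finally show ?thesis by simp
  qed
  show ?thesis
  proof (rule that[OF pos nu nv])
    show "W *v v = \<sigma> *\<^sub>R u" by (rule eq[OF n1 nu]) (simp add: \<sigma>_def)
    show "u v* W = \<sigma> *\<^sub>R v"
      by (rule eq[OF n2 nv]) (simp only: \<sigma>_def inner_eq inner_commute[of v])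
  qed
qed

text \<open>Subtracting the top rank-one term \<open>\<sigma> u v\<^sup>T\<close> removes \<open>u\<close> from the range, so the induction is on
  the rank. The induction carries positivity of the singular values because only then do the singular
  vectors of the remainder lie in its range and row space, which are orthogonal to \<open>u\<close> and \<open>v\<close>;
  a singular vector for the value \<open>0\<close> could be \<open>u\<close> itself.\<close>

lemma positive_svd_exists:
  fixes W :: "real^'n^'m"
  shows "\<exists>r U d V. is_svd W r U d V \<and> (\<forall>k<r. 0 < d k)"
proof (induction "dim (range ((*v) W))" arbitrary: W rule: less_induct)
  case less
  show ?case
  proof (cases "W = 0")
    case True
    then have "is_svd W 0 (\<lambda>_. 0) (\<lambda>_. 0) (\<lambda>_. 0)"
      by (simp add: is_svd_def orthonormal_cols_def UdV_def vec_eq_iff)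
    then show ?thesis by force
  next
    case False
    then obtain \<sigma> u v where \<sigma>: "\<sigma> > 0" and nu: "norm u = 1" and nv: "norm v = 1"
      and Wv: "W *v v = \<sigma> *\<^sub>R u" and Wu: "u v* W = \<sigma> *\<^sub>R v"
      by (rule top_singular_pair)
    define W' :: "real^'n^'m" where "W' = W - (\<chi> i j. u $ i * \<sigma> * v $ j)"
    have W'x: "W' *v x = W *v x - (\<sigma> * (v \<bullet> x)) *\<^sub>R u" for x
      by (simp add: W'_def matrix_vector_mult_diff_rdistrib)
        (simp add: vec_eq_iff matrix_vector_mult_def inner_vec_def sum_distrib_left mult_ac)
    have uu: "u \<bullet> u = 1" and vv: "v \<bullet> v = 1" using nu nv by (simp_all add: norm_eq_1)
    have uW': "u \<bullet> (W' *v x) = 0" for x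
    proof -
      have "u \<bullet> (W *v x) = (u v* W) \<bullet> x"
        by (simp add: dot_lmul_matrix)
      then show ?thesis by (simp add: W'x Wu inner_diff_right uu)
    qed
    have W'v: "W' *v v = 0" by (simp add: W'x Wv vv)
    have sub: "range ((*v) W') \<subseteq> range ((*v) W)"
    proof
      fix b assume "b \<in> range ((*v) W')"
      then obtain x where "b = W' *v x" by blast
      then have "b = W *v (x - (v \<bullet> x) *\<^sub>R v)"
        by (simp add: W'x matrix_vector_mult_diff_distrib matrix_vector_mult_scaleR Wv mult_ac)
      then show "b \<in> range ((*v) W)" by blast
    qed
    have uin: "u \<in> range ((*v) W)"
    proof
      show "u = W *v (v /\<^sub>R \<sigma>)" using \<sigma> by (simp add: matrix_vector_mult_scaleR Wv)
    qed simp
    have unotin: "u \<notin> range ((*v) W')" using uW' uu by force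
    have sp: "span (range ((*v) A)) = range ((*v) A)" for A :: "real^'n^'m"
      by (simp add: linear_subspace_image)
    have "dim (range ((*v) W')) < dim (range ((*v) W))"
      by (rule dim_psubset) (use sub uin unotin sp in blast)
    from less[OF this] obtain r U d V where
      svd: "is_svd W' r U d V" and d: "\<forall>k<r. 0 < d k" by blast
    have oU: "orthonormal_cols r U" and oV: "orthonormal_cols r V" and W'eq: "W' = UdV r U d V"
      using svd by (auto simp: is_svd_def)
    have W'V: "W' *v V k = d k *\<^sub>R U k" if "k < r" for k
    proof -
      have "W' *v V k = (\<Sum>j<r. if j = k then d k *\<^sub>R U k else 0)"
        unfolding W'eq UdV_mult_vec using oV that
        by (intro sum.cong) (auto simp: orthonormal_cols_def)
      then show ?thesis using that by simp
    qed
    have Uu: "U k \<bullet> u = 0" if "k < r" for k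
      using uW'[of "V k"] W'V[OF that] d that by (auto simp: inner_commute)
    have Vv: "V k \<bullet> v = 0" if "k < r" for k
    proof -
      have "d k * (V k \<bullet> v) = U k \<bullet> (W' *v v)"
      proof -
        have "U k \<bullet> (W' *v v) = (\<Sum>j<r. if j = k then d k * (V k \<bullet> v) else 0)"
          unfolding W'eq UdV_mult_vec inner_sum_right using oU that
          by (intro sum.cong) (auto simp: orthonormal_cols_def)
        then show ?thesis using that by simp
      qed
      then show ?thesis using W'v d that by auto
    qed
    have "is_svd W (Suc r) (U(r := u)) (d(r := \<sigma>)) (V(r := v))"
      unfolding is_svd_def
    proof (intro conjI)
      have "W = UdV r U d V + (\<chi> i j. u $ i * \<sigma> * v $ j)"
        unfolding W'eq[symmetric] W'_def by simp
      then show "W = UdV (Suc r) (U(r := u)) (d(r := \<sigma>)) (V(r := v))"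
        by (simp add: UdV_def vec_eq_iff)
    qed (use orthonormal_cols_Suc[OF oU Uu nu] orthonormal_cols_Suc[OF oV Vv nv] d \<sigma>
        in \<open>auto simp: less_Suc_eq less_imp_le\<close>)
    moreover have "\<forall>k<Suc r. 0 < (d(r := \<sigma>)) k" using d \<sigma> by (simp add: less_Suc_eq)
    ultimately show ?thesis by blast
  qed
qed

lemma svd_exists:
  fixes W :: "real^'n^'m"
  obtains r U d V where "is_svd W r U d V"
  using positive_svd_exists by blast

section \<open>Duality between the spectral and the nuclear norm\<close>

lemma orthonormal_cols_Bessel:
  assumes "orthonormal_cols r U"
  shows "(\<Sum>k<r. (U k \<bullet> x)\<^sup>2) \<le> (norm x)\<^sup>2"
proof -
  let ?p = "\<Sum>k<r. (U k \<bullet> x) *\<^sub>R U k"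
  have px: "?p \<bullet> x = (\<Sum>k<r. (U k \<bullet> x)\<^sup>2)"
    by (simp add: inner_sum_left power2_eq_square)
  have "?p \<bullet> U k = U k \<bullet> x" if "k < r" for k
  proof -
    have "?p \<bullet> U k = (\<Sum>j<r. if j = k then U k \<bullet> x else 0)"
      unfolding inner_sum_left using assms that
      by (intro sum.cong) (auto simp: orthonormal_cols_def)
    then show ?thesis using that by simp
  qed
  then have pp: "?p \<bullet> ?p = (\<Sum>k<r. (U k \<bullet> x)\<^sup>2)"
    by (subst inner_sum_right) (simp add: power2_eq_square)
  have "0 \<le> (x - ?p) \<bullet> (x - ?p)" by simp
  also have "\<dots> = (norm x)\<^sup>2 - (\<Sum>k<r. (U k \<bullet> x)\<^sup>2)"
    using px pp by (simp add: inner_diff_left inner_diff_right inner_commute[of x ?p]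
        power2_norm_eq_inner)
  finally show ?thesis by simp
qed

text \<open>Spectral norm at most \<open>a\<close> on the left, nuclear norm on the right. By linearity one rank-one term
  \<open>u v\<^sup>T\<close> on the right is enough, and there \<open>x z \<le> (x\<^sup>2 + z\<^sup>2) / 2\<close> reduces the claim to Bessel's
  inequality for \<open>u\<close> and for \<open>v\<close>.\<close>

lemma inner_UdV_le:
  assumes U: "orthonormal_cols r U" and V: "orthonormal_cols r V"
    and U': "orthonormal_cols r' U'" and V': "orthonormal_cols r' V'"
    and a: "0 \<le> a" and c: "\<forall>k<r. 0 \<le> c k \<and> c k \<le> a" and d: "\<forall>k<r'. 0 \<le> d k"
  shows "UdV r U c V \<bullet> UdV r' U' d V' \<le> a * (\<Sum>l<r'. d l)"
proof -
  have bound: "(\<Sum>k<r. c k * ((U k \<bullet> U' l) * (V k \<bullet> V' l))) \<le> a" if l: "l < r'" for l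
  proof -
    have "norm (U' l) = 1" "norm (V' l) = 1"
      using U' V' l by (auto simp: orthonormal_cols_def norm_eq_1)
    then have B: "(\<Sum>k<r. (U k \<bullet> U' l)\<^sup>2) \<le> 1" "(\<Sum>k<r. (V k \<bullet> V' l)\<^sup>2) \<le> 1"
      using orthonormal_cols_Bessel[OF U, of "U' l"] orthonormal_cols_Bessel[OF V, of "V' l"]
      by simp_all
    have "c k * ((U k \<bullet> U' l) * (V k \<bullet> V' l))
        \<le> a * (((U k \<bullet> U' l)\<^sup>2 + (V k \<bullet> V' l)\<^sup>2) / 2)" if "k < r" for k
    proof -
      have "0 \<le> c k" "c k \<le> a" using c that by auto
      moreover have "x * z \<le> (x\<^sup>2 + z\<^sup>2) / 2" for x z :: real
        using sum_squares_bound[of x z] by simp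
      ultimately show ?thesis
        by (meson mult_left_mono mult_right_mono order_trans sum_power2_ge_zero
            divide_nonneg_pos zero_less_numeral)
    qed
    then have "(\<Sum>k<r. c k * ((U k \<bullet> U' l) * (V k \<bullet> V' l)))
        \<le> (\<Sum>k<r. a * (((U k \<bullet> U' l)\<^sup>2 + (V k \<bullet> V' l)\<^sup>2) / 2))"
      by (intro sum_mono) auto
    also have "\<dots> = a * (((\<Sum>k<r. (U k \<bullet> U' l)\<^sup>2) + (\<Sum>k<r. (V k \<bullet> V' l)\<^sup>2)) / 2)"
      by (simp only: sum_distrib_left[symmetric] sum_divide_distrib[symmetric] sum.distrib)
    also have "\<dots> \<le> a * 1" using a B by (intro mult_left_mono) auto
    finally show ?thesis by simp
  qed
  have "UdV r U c V \<bullet> UdV r' U' d V'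
      = (\<Sum>k<r. \<Sum>l<r'. d l * (c k * ((U k \<bullet> U' l) * (V k \<bullet> V' l))))"
    by (simp add: inner_UdV UdV_mult_vec inner_sum_right sum_distrib_left
        inner_commute[of "V' _"] mult_ac)
  also have "\<dots> = (\<Sum>l<r'. d l * (\<Sum>k<r. c k * ((U k \<bullet> U' l) * (V k \<bullet> V' l))))"
    by (subst sum.swap) (simp add: sum_distrib_left)
  also have "\<dots> \<le> (\<Sum>l<r'. d l * a)"
    using d bound by (intro sum_mono mult_left_mono) auto
  finally show ?thesis by (simp add: sum_distrib_left mult.commute)
qed

lemma inner_UdV_same:
  assumes "orthonormal_cols r U" and "orthonormal_cols r V"
  shows "UdV r U c V \<bullet> UdV r U d V = (\<Sum>k<r. c k * d k)"
proof -
  have "U k \<bullet> (UdV r U d V *v V k) = d k" if "k < r" for k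
  proof -
    have "U k \<bullet> (UdV r U d V *v V k) = (\<Sum>j<r. if j = k then d k else 0)"
      unfolding UdV_mult_vec inner_sum_right using assms that
      by (intro sum.cong) (auto simp: orthonormal_cols_def)
    then show ?thesis using that by simp
  qed
  then show ?thesis by (simp add: inner_UdV)
qed

text \<open>The matrix \<open>U V\<^sup>T\<close> of the first decomposition is a dual certificate: it has spectral norm at most
  \<open>1\<close>, and its inner product with \<open>M\<close> is \<open>\<Sum>d\<close>. With the roles exchanged, this shows that the
  nuclear norm is well defined.\<close>

lemma svd_sum_le:
  assumes "is_svd M r U d V" and "is_svd M r' U' d' V'"
  shows "(\<Sum>k<r. d k) \<le> (\<Sum>k<r'. d' k)"
proof -
  have "(\<Sum>k<r. d k) = UdV r U (\<lambda>_. 1) V \<bullet> M"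
    using assms(1) by (auto simp: is_svd_def inner_UdV_same)
  also have "\<dots> = UdV r U (\<lambda>_. 1) V \<bullet> UdV r' U' d' V'"
    using assms(2) by (simp add: is_svd_def)
  also have "\<dots> \<le> 1 * (\<Sum>k<r'. d' k)"
    using assms by (intro inner_UdV_le) (auto simp: is_svd_def)
  finally show ?thesis by simp
qed

lemma nuclear_norm_eq:
  assumes "is_svd M r U d V"
  shows "nuclear_norm M = (\<Sum>k<r. d k)"
  unfolding nuclear_norm_def
proof (rule the_equality)
  show "\<exists>r' U' d' V'. is_svd M r' U' d' V' \<and> (\<Sum>k<r. d k) = (\<Sum>k<r'. d' k)"
    using assms by blast
next
  fix s assume "\<exists>r U d V. is_svd M r U d V \<and> s = (\<Sum>k<r. d k)"
  then show "s = (\<Sum>k<r. d k)"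
    using assms by (metis svd_sum_le order_antisym)
qed

lemma nuclear_norm_scaleR:
  fixes M :: "real^'n^'m"
  assumes "0 \<le> c"
  shows "nuclear_norm (c *\<^sub>R M) = c * nuclear_norm M"
proof -
  obtain r U d V where svd: "is_svd M r U d V" by (rule svd_exists)
  then have "is_svd (c *\<^sub>R M) r U (\<lambda>k. c * d k) V"
    using assms by (auto simp: is_svd_def UdV_def vec_eq_iff sum_distrib_left mult_ac)
  then show ?thesis using svd by (simp add: nuclear_norm_eq sum_distrib_left)
qed

section \<open>Soft-thresholding as a proximal map\<close>

text \<open>The condition \<open>W - S \<in> a \<partial>N(S)\<close> for the nuclear norm \<open>N\<close>, that is, optimality of \<open>S\<close> for
  \<open>(norm (M - W))\<^sup>2 / 2 + a N(M)\<close>. The subgradient inequality of a norm splits into the two parts below: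
  a dual-norm bound, and equality at \<open>S\<close>. The predicate holds the facts about thresholding
  that do not refer to a chosen decomposition.\<close>

definition nuclear_prox :: "real^'n^'m \<Rightarrow> real \<Rightarrow> real^'n^'m \<Rightarrow> bool" where
  "nuclear_prox W a S \<longleftrightarrow>
     (\<forall>M. (W - S) \<bullet> M \<le> a * nuclear_norm M) \<and> (W - S) \<bullet> S = a * nuclear_norm S"

lemma nuclear_prox_UdV:
  assumes svd: "is_svd W r U d V" and a: "0 \<le> a"
  shows "nuclear_prox W a (UdV r U (\<lambda>k. max (d k - a) 0) V)"
proof -
  let ?S = "UdV r U (\<lambda>k. max (d k - a) 0) V"
  have oU: "orthonormal_cols r U" and oV: "orthonormal_cols r V"
    and d: "\<forall>k<r. 0 \<le> d k" and W: "W = UdV r U d V"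
    using svd by (auto simp: is_svd_def)
  have svdS: "is_svd ?S r U (\<lambda>k. max (d k - a) 0) V"
    using oU oV by (simp add: is_svd_def)
  have min: "d k - max (d k - a) 0 = min (d k) a" for k by auto
  have diff: "W - ?S = UdV r U (\<lambda>k. min (d k) a) V"
    unfolding W min[symmetric]
    by (simp add: UdV_def vec_eq_iff sum_subtractf[symmetric] algebra_simps)
  have "(W - ?S) \<bullet> M \<le> a * nuclear_norm M" for M
  proof -
    obtain r' U' d' V' where M: "is_svd M r' U' d' V'" by (rule svd_exists)
    then have "(W - ?S) \<bullet> UdV r' U' d' V' \<le> a * (\<Sum>k<r'. d' k)"
      unfolding diff using oU oV a d by (intro inner_UdV_le) (auto simp: is_svd_def)
    then show ?thesis using nuclear_norm_eq[OF M] M by (simp add: is_svd_def)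
  qed
  moreover have "(W - ?S) \<bullet> ?S = a * nuclear_norm ?S"
    unfolding nuclear_norm_eq[OF svdS] diff inner_UdV_same[OF oU oV] sum_distrib_left
    by (intro sum.cong) (auto simp: max_def min_def)
  ultimately show ?thesis by (simp add: nuclear_prox_def)
qed

text \<open>This is monotonicity of the subdifferential: the residuals satisfy
  \<open>((W1 - S1) - (W2 - S2)) \<bullet> (S1 - S2) \<ge> 0\<close>. The case \<open>W1 = W2\<close> says that \<open>W\<close> and \<open>a\<close> determine \<open>S\<close>.\<close>

lemma nuclear_prox_nonexpansive:
  assumes "nuclear_prox W1 a S1" and "nuclear_prox W2 a S2"
  shows "norm (S1 - S2) \<le> norm (W1 - W2)"
proof -
  have "(W1 - S1) \<bullet> S2 \<le> (W2 - S2) \<bullet> S2" "(W2 - S2) \<bullet> S1 \<le> (W1 - S1) \<bullet> S1"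
    using assms by (simp_all add: nuclear_prox_def)
  then have "(S1 - S2) \<bullet> (S1 - S2) \<le> (W1 - W2) \<bullet> (S1 - S2)"
    by (simp add: inner_diff_left inner_diff_right)
  also have "\<dots> \<le> norm (W1 - W2) * norm (S1 - S2)"
    by (rule norm_cauchy_schwarz)
  finally have "norm (S1 - S2) * norm (S1 - S2) \<le> norm (W1 - W2) * norm (S1 - S2)"
    by (simp add: dot_square_norm power2_eq_square)
  then show ?thesis
    by (cases "norm (S1 - S2) = 0") (simp, simp add: mult_le_cancel_right)
qed

lemma nuclear_prox_soft_svd:
  fixes W :: "real^'n^'m"
  assumes a: "0 \<le> a" and b: "0 \<le> b"
  shows "nuclear_prox W a ((1 + b) *\<^sub>R soft_svd W a b)"
proof -
  have scale: "UdV r U (\<lambda>k. max (d k - a) 0 / (1 + b)) V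
      = (1 / (1 + b)) *\<^sub>R UdV r U (\<lambda>k. max (d k - a) 0) V" for r d and U :: "nat \<Rightarrow> real^'m" and V :: "nat \<Rightarrow> real^'n"
    by (simp add: UdV_def vec_eq_iff sum_distrib_left sum_divide_distrib)
  obtain r U d V where svd: "is_svd W r U d V" by (rule svd_exists)
  let ?S = "UdV r U (\<lambda>k. max (d k - a) 0) V"
  have "soft_svd W a b = (1 / (1 + b)) *\<^sub>R ?S"
    unfolding soft_svd_def scale
  proof (rule the_equality)
    fix S assume "\<exists>r U d V. is_svd W r U d V
        \<and> S = (1 / (1 + b)) *\<^sub>R UdV r U (\<lambda>k. max (d k - a) 0) V"
    then obtain r' U' d' V' where svd': "is_svd W r' U' d' V'"
      and S: "S = (1 / (1 + b)) *\<^sub>R UdV r' U' (\<lambda>k. max (d' k - a) 0) V'" by blast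
    show "S = (1 / (1 + b)) *\<^sub>R ?S"
      using nuclear_prox_nonexpansive[OF nuclear_prox_UdV[OF svd' a] nuclear_prox_UdV[OF svd a]]
      by (simp add: S)
  qed (use svd in blast)
  then show ?thesis using nuclear_prox_UdV[OF svd a] b by simp
qed

lemma soft_svd_lipschitz:
  assumes "0 \<le> a" and "0 \<le> b"
  shows "dist (soft_svd W1 a b) (soft_svd W2 a b) \<le> dist W1 W2 / (1 + b)"
proof -
  have "norm ((1 + b) *\<^sub>R soft_svd W1 a b - (1 + b) *\<^sub>R soft_svd W2 a b) \<le> norm (W1 - W2)"
    by (intro nuclear_prox_nonexpansive[where a = a] nuclear_prox_soft_svd assms)
  then have "(1 + b) * dist (soft_svd W1 a b) (soft_svd W2 a b) \<le> dist W1 W2"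
    using assms(2) by (simp add: dist_norm flip: scaleR_diff_right)
  then show ?thesis using assms(2) by (simp add: pos_le_divide_eq mult.commute)
qed

section \<open>The EM map and its fixed point\<close>

lemma E_step_nonexpansive:
  "dist (E_step n \<omega> y m Z1) (E_step n \<omega> y m Z2) \<le> dist Z1 Z2"
  unfolding dist_norm
proof (intro norm_le_componentwise_cart)
  fix i j
  let ?c = "max (1 - real (obs_count n \<omega> (i, j)) / real m) 0"
  have "(E_step n \<omega> y m Z1 - E_step n \<omega> y m Z2) $ i $ j = ?c * (Z1 - Z2) $ i $ j"
    by (simp add: E_step_def algebra_simps)
  moreover have "\<bar>?c\<bar> \<le> 1" by simp
  ultimately show "norm ((E_step n \<omega> y m Z1 - E_step n \<omega> y m Z2) $ i $ j) \<le> norm ((Z1 - Z2) $ i $ j)"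
    by (metis abs_ge_zero abs_mult mult_left_le_one_le real_norm_def)
qed

lemma em_map_contraction:
  assumes "0 \<le> l1" and "0 \<le> l2"
  shows "dist (M_step l1 l2 m (E_step n \<omega> y m Z1)) (M_step l1 l2 m (E_step n \<omega> y m Z2))
    \<le> 1 / (1 + l2 / real m) * dist Z1 Z2"
proof -
  have "dist (M_step l1 l2 m (E_step n \<omega> y m Z1)) (M_step l1 l2 m (E_step n \<omega> y m Z2))
      \<le> dist (E_step n \<omega> y m Z1) (E_step n \<omega> y m Z2) / (1 + l2 / real m)"
    unfolding M_step_def using assms by (intro soft_svd_lipschitz) simp_all
  also have "\<dots> \<le> dist Z1 Z2 / (1 + l2 / real m)"
    using assms by (intro divide_right_mono E_step_nonexpansive) simp
  finally show ?thesis by simp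
qed

text \<open>For \<open>m\<^sub>\<omega> \<le> m\<^sub>*\<close> the truncations in the E-step are inactive, so the increment at position \<open>\<omega>\<close>
  is \<open>m\<^sub>\<omega> / m\<^sub>*\<close> times the difference between the observed mean and \<open>Z\<^sub>\<omega>\<close>. The right-hand side is the
  derivative at \<open>Z\<close>, in direction \<open>D\<close>, of the negative data term of the objective.\<close>

lemma E_step_residual:
  fixes D :: "real^'n^'m"
  assumes m: "m \<ge> 1" and le: "max_obs_count n \<omega> \<le> m"
  shows "real m * ((E_step n \<omega> y m Z - Z) \<bullet> D)
    = (\<Sum>i=1..n. (y i - entry Z (\<omega> i)) * entry D (\<omega> i))"
proof -
  have cnt: "obs_count n \<omega> w \<le> m" for w
  proof -
    have "obs_count n \<omega> w \<le> max_obs_count n \<omega>"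
      unfolding max_obs_count_def by (intro Max_ge) auto
    then show ?thesis using le by linarith
  qed
  have res: "real m * entry (E_step n \<omega> y m Z - Z) w = (\<Sum>i | i \<in> {1..n} \<and> \<omega> i = w. y i - entry Z w)"
    for w
  proof -
    let ?c = "real (obs_count n \<omega> w)"
    have c: "?c \<le> real m" "real m > 0" using cnt[of w] m by auto
    have cY: "?c * Y_obs n \<omega> y w = (\<Sum>i | i \<in> {1..n} \<and> \<omega> i = w. y i)"
    proof (cases "obs_count n \<omega> w = 0")
      case True
      then have "{i. i \<in> {1..n} \<and> \<omega> i = w} = {}" by (simp add: obs_count_def)
      then have "(\<Sum>i | i \<in> {1..n} \<and> \<omega> i = w. y i) = 0" by (metis sum.empty)
      then show ?thesis using True by simp
    qed (simp add: Y_obs_def)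
    have "real m * entry (E_step n \<omega> y m Z - Z) w
        = real m * (?c / real m * Y_obs n \<omega> y w + (1 - ?c / real m) * entry Z w - entry Z w)"
      using c by (simp add: E_step_def)
    also have "\<dots> = ?c * Y_obs n \<omega> y w - ?c * entry Z w"
      using c by (simp add: field_simps)
    finally show ?thesis by (simp add: cY sum_subtractf) (simp add: obs_count_def)
  qed
  have "real m * ((E_step n \<omega> y m Z - Z) \<bullet> D)
      = (\<Sum>w\<in>UNIV. real m * entry (E_step n \<omega> y m Z - Z) w * entry D w)"
    by (simp add: inner_vec_def sum_distrib_left sum.cartesian_product case_prod_unfold mult_ac)
  also have "\<dots> = (\<Sum>w\<in>UNIV. \<Sum>i | i \<in> {1..n} \<and> \<omega> i = w. (y i - entry Z (\<omega> i)) * entry D (\<omega> i))"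
    unfolding res sum_distrib_right by (intro sum.cong) auto
  also have "\<dots> = (\<Sum>i=1..n. (y i - entry Z (\<omega> i)) * entry D (\<omega> i))"
    by (rule sum.group) auto
  finally show ?thesis .
qed

text \<open>The term \<open>l2 / 2 * (norm (M - Z))\<^sup>2\<close> is the strong convexity of the ridge penalty. The remaining part
  of the objective is convex, and \<open>Z\<close> satisfies the first-order condition for the whole.\<close>

lemma em_fixed_point_objective_gap:
  fixes Z M :: "real^'n^'m"
  assumes l1: "0 \<le> l1" and l2: "0 \<le> l2" and m: "m \<ge> 1" and le: "max_obs_count n \<omega> \<le> m"
    and fp: "M_step l1 l2 m (E_step n \<omega> y m Z) = Z"
  shows "objective n \<omega> y l1 l2 Z + l2 / 2 * (norm (M - Z))\<^sup>2 \<le> objective n \<omega> y l1 l2 M"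
proof -
  let ?Y = "E_step n \<omega> y m Z" and ?D = "M - Z"
  define c where "c = 1 + l2 / real m"
  define N :: "real^'n^'m \<Rightarrow> real" where "N = nuclear_norm"
  have c: "c > 0" and mpos: "real m > 0" using l2 m by (simp_all add: c_def add_pos_nonneg)
  have prox: "nuclear_prox ?Y (l1 / real m) (c *\<^sub>R Z)"
    using nuclear_prox_soft_svd[of "l1 / real m" "l2 / real m" ?Y] l1 l2 fp
    by (simp add: M_step_def c_def)
  \<comment> \<open>The thresholded matrix is \<open>c Z\<close>; homogeneity of the nuclear norm turns this into a subgradient at \<open>Z\<close>.\<close>
  have "c * ((?Y - c *\<^sub>R Z) \<bullet> Z) = c * (l1 / real m * N Z)"
    using prox c by (simp add: nuclear_prox_def nuclear_norm_scaleR N_def)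
  then have "(?Y - c *\<^sub>R Z) \<bullet> Z = l1 / real m * N Z"
    using c by (simp only: mult_cancel_left) simp
  moreover have "(?Y - c *\<^sub>R Z) \<bullet> M \<le> l1 / real m * N M"
    using prox by (simp add: nuclear_prox_def N_def)
  ultimately have "(?Y - c *\<^sub>R Z) \<bullet> ?D \<le> l1 / real m * (N M - N Z)"
    by (simp only: inner_diff_right right_diff_distrib)
  then have "real m * ((?Y - c *\<^sub>R Z) \<bullet> ?D) \<le> l1 * (N M - N Z)"
    using mpos by (simp add: field_simps)
  moreover have "real m * ((?Y - c *\<^sub>R Z) \<bullet> ?D) = real m * ((?Y - Z) \<bullet> ?D) - l2 * (Z \<bullet> ?D)"
    using mpos by (simp add: c_def inner_diff_left algebra_simps)
  \<comment> \<open>First-order optimality of \<open>Z\<close> in the direction \<open>M - Z\<close>.\<close>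
  ultimately have opt: "(\<Sum>i=1..n. (y i - entry Z (\<omega> i)) * entry ?D (\<omega> i)) - l2 * (Z \<bullet> ?D)
      \<le> l1 * (N M - N Z)"
    by (simp only: E_step_residual[OF m le])
  \<comment> \<open>The data term is quadratic, so its second-order expansion at \<open>Z\<close> is exact.\<close>
  have "(\<Sum>i=1..n. (entry M (\<omega> i))\<^sup>2 / 2) - (\<Sum>i=1..n. y i * entry M (\<omega> i))
      - ((\<Sum>i=1..n. (entry Z (\<omega> i))\<^sup>2 / 2) - (\<Sum>i=1..n. y i * entry Z (\<omega> i)))
      + (\<Sum>i=1..n. (y i - entry Z (\<omega> i)) * entry ?D (\<omega> i))
      = (\<Sum>i=1..n. (entry ?D (\<omega> i))\<^sup>2 / 2)"
    unfolding sum_subtractf[symmetric] sum.distrib[symmetric]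
    by (intro sum.cong) (auto simp: power2_eq_square field_simps)
  moreover have "0 \<le> (\<Sum>i=1..n. (entry ?D (\<omega> i))\<^sup>2 / 2)"
    by (intro sum_nonneg) simp
  moreover have "l2 / 2 * (norm M)\<^sup>2 = l2 / 2 * (norm Z)\<^sup>2 + l2 * (Z \<bullet> ?D) + l2 / 2 * (norm ?D)\<^sup>2"
    unfolding power2_norm_eq_inner
    by (simp add: inner_diff_left inner_diff_right inner_commute[of M Z] algebra_simps)
  moreover have "l1 * (N M - N Z) = l1 * N M - l1 * N Z" by (rule right_diff_distrib)
  ultimately show ?thesis
    using opt unfolding objective_def N_def by linarith
qed

theorem theorem1:
  fixes n :: nat and \<omega> :: "nat \<Rightarrow> 'm::finite \<times> 'n::finite" and y :: "nat \<Rightarrow> real"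
    and l1 l2 :: real and m :: nat
  assumes "l1 \<ge> 0" and "l2 > 0" and "m \<ge> 1"
  shows "\<exists>Zinf :: real^'n^'m.
           (\<forall>Z0. (\<lambda>k. em_iter n \<omega> y l1 l2 m Z0 k) \<longlonglongrightarrow> Zinf) \<and>
           (m \<ge> max_obs_count n \<omega> \<longrightarrow>
              {M. is_arg_min (objective n \<omega> y l1 l2) (\<lambda>_. True) M} = {Zinf})"
proof -
  let ?F = "\<lambda>Z :: real^'n^'m. M_step l1 l2 m (E_step n \<omega> y m Z)"
  define q where "q = 1 / (1 + l2 / real m)"
  have q: "0 \<le> q" "q < 1" using assms by (simp_all add: q_def add_pos_pos)
  have contr: "dist (?F Z1) (?F Z2) \<le> q * dist Z1 Z2" for Z1 Z2
    unfolding q_def using assms by (intro em_map_contraction) simp_all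
  have "\<exists>!Z. Z \<in> UNIV \<and> ?F Z = Z"
    using contr q by (intro Banach_fix) (auto simp: complete_UNIV)
  then obtain Zinf where fp: "?F Zinf = Zinf" by blast
  have "(\<lambda>k. em_iter n \<omega> y l1 l2 m Z0 k) \<longlonglongrightarrow> Zinf" for Z0
  proof -
    have bound: "dist (em_iter n \<omega> y l1 l2 m Z0 k) Zinf \<le> q ^ k * dist Z0 Zinf" for k
    proof (induction k)
      case (Suc k)
      have "dist (em_iter n \<omega> y l1 l2 m Z0 (Suc k)) Zinf
          \<le> q * dist (em_iter n \<omega> y l1 l2 m Z0 k) Zinf"
        using contr[of "em_iter n \<omega> y l1 l2 m Z0 k" Zinf] fp by simp
      also have "\<dots> \<le> q * (q ^ k * dist Z0 Zinf)"
        using Suc q by (intro mult_left_mono)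
      finally show ?case by (simp add: mult_ac)
    qed simp
    have "(\<lambda>k. q ^ k * dist Z0 Zinf) \<longlonglongrightarrow> 0"
      using q by (intro tendsto_mult_left_zero LIMSEQ_realpow_zero)
    then have "(\<lambda>k. dist (em_iter n \<omega> y l1 l2 m Z0 k) Zinf) \<longlonglongrightarrow> 0"
      by (rule Lim_null_comparison[rotated]) (simp add: bound)
    then show ?thesis by (rule tendsto_dist_iff[THEN iffD2])
  qed
  moreover have "{M. is_arg_min (objective n \<omega> y l1 l2) (\<lambda>_. True) M} = {Zinf}"
    if "m \<ge> max_obs_count n \<omega>"
  proof -
    have gap: "objective n \<omega> y l1 l2 Zinf + l2 / 2 * (norm (M - Zinf))\<^sup>2 \<le> objective n \<omega> y l1 l2 M" for M
      using assms that fp by (intro em_fixed_point_objective_gap) simp_all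
    have strict: "objective n \<omega> y l1 l2 Zinf < objective n \<omega> y l1 l2 M" if "M \<noteq> Zinf" for M
    proof -
      have "0 < l2 / 2 * (norm (M - Zinf))\<^sup>2" using that assms by simp
      then show ?thesis using gap[of M] by linarith
    qed
    show ?thesis
      unfolding is_arg_min_def by (auto; metis strict less_asym less_irrefl)
  qed
  ultimately show ?thesis by blast
qed

end
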